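(* Let $e,s\ge 1$ be integers and let $\underline{v}=(v_1,\ldots,v_e,v_{e+1},\ldots,v_{e+s})$ be nonzero elements of $\mathbb{N}^e$ such that $v_1,\ldots,v_e$ generate $\mathbb{R}^e$ as a vector space and $v_{e+1},\ldots,v_{e+s}\in \mathrm{cone}(v_1,\ldots,v_e)$. Let $D_1,\ldots,D_{s+1}$ and $e_k=D_k/D_{k+1}$ ($1\le k\le s$) be as defined in the context, and assume that ( * ) $D_1>D_2>\cdots>D_{s+1}$; ( ** ) $e_kv_{e+k}\in\Gamma(v_1,\ldots,v_e,v_{e+1},\ldots,v_{e+k-1})$ for all $k=1,\ldots,s$. Let $C_e$ be the interior of $\mathrm{cone}(v_1,\ldots,v_e)$ in $\mathbb{R}^e$, and set $$g(\underline{v})=\sum_{k=1}^s (e_k-1)v_{e+k}-\sum_{i=1}^e v_i .$$ Then the following hold: i) $g(\underline{v})\notin\Gamma(\underline{v})$. ii) For all $v\in g(\underline{v})+(C_e-\{(0,\ldots,0)\})$, if $v\in G(\underline{v})$, then $v\in\Gamma(\underline{v})$.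
   Context: Here $\mathbb{N}$ contains $0$. For vectors $u_1,\ldots,u_m\in\mathbb{N}^e$, $\Gamma(u_1,\ldots,u_m)=\{\sum_{i=1}^m a_iu_i : a_i\in\mathbb{N}\}$ is the subsemigroup of $\mathbb{N}^e$ generated by them, $G(u_1,\ldots,u_m)=\{\sum_{i=1}^m a_iu_i : a_i\in\mathbb{Z}\}$ is the subgroup of $\mathbb{Z}^e$ generated by them, and $\mathrm{cone}(u_1,\ldots,u_m)=\{\sum_{i=1}^m a_iu_i : a_i\in\mathbb{R}_+\}$ where $\mathbb{R}_+=[0,\infty)$. Write $\Gamma(\underline{v})=\Gamma(v_1,\ldots,v_{e+s})$ and $G(\underline{v})=G(v_1,\ldots,v_{e+s})$. $D_1$ is the absolute value of the determinant of the $e\times e$ matrix $[v_1^T,\ldots,v_e^T]$ whose columns are $v_1,\ldots,v_e$. For $k=2,\ldots,s+1$, $D_k$ is the (positive) gcd of the $e\times e$ minors of the matrix $[v_1^T,\ldots,v_e^T,v_{e+1}^T,\ldots,v_{e+k-1}^T]$. For $k=1,\ldots,s$, $e_k=D_k/D_{k+1}$, which is a positive integer. For a vector $a$ and a set $S$, $a+S=\{a+x : x\in S\}$. *)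

theory Defs
  imports "HOL-Analysis.Analysis"
begin

text \<open>
  The coordinates of \<open>\<nat>\<^sup>e\<close>, \<open>\<int>\<^sup>e\<close> and \<open>\<real>\<^sup>e\<close> are indexed by a finite linearly ordered type \<open>'e\<close>
  standing for \<open>{1..e}\<close>, so \<open>e = CARD('e)\<close> and \<open>e \<ge> 1\<close> holds automatically.  The order is used only
  to list the columns of matrices.  A sequence \<open>v\<^sub>1, \<dots>, v\<^sub>m\<close> is a function on \<open>nat\<close> of which only
  the values on \<open>{1..m}\<close> matter.  All of \<open>\<nat>\<^sup>e \<subseteq> \<int>\<^sup>e \<subseteq> \<real>\<^sup>e\<close> is viewed inside \<^typ>\<open>real^'e\<close>.
\<close>

definition real_vec :: "nat ^ 'e \<Rightarrow> real ^ 'e" where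
  "real_vec u = (\<chi> i. real (u $ i))"

definition gen_semigroup :: "(nat \<Rightarrow> nat ^ 'e) \<Rightarrow> nat \<Rightarrow> (real ^ 'e) set" where
  "gen_semigroup v m = {\<Sum>i=1..m. real (a i) *\<^sub>R real_vec (v i) | a :: nat \<Rightarrow> nat. True}"

definition gen_group :: "(nat \<Rightarrow> nat ^ 'e) \<Rightarrow> nat \<Rightarrow> (real ^ 'e) set" where
  "gen_group v m = {\<Sum>i=1..m. real_of_int (a i) *\<^sub>R real_vec (v i) | a :: nat \<Rightarrow> int. True}"

definition gen_cone :: "(nat \<Rightarrow> nat ^ 'e) \<Rightarrow> nat \<Rightarrow> (real ^ 'e) set" where
  "gen_cone v m = {\<Sum>i=1..m. a i *\<^sub>R real_vec (v i) | a :: nat \<Rightarrow> real. \<forall>i. a i \<ge> 0}"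

text \<open>
  The square matrix whose \<open>c\<close>-th column is \<open>v (f c)\<close>.
\<close>

definition column_matrix :: "(nat \<Rightarrow> nat ^ 'e) \<Rightarrow> ('e \<Rightarrow> nat) \<Rightarrow> int ^ 'e ^ 'e" where
  "column_matrix v f = (\<chi> r c. int (v (f c) $ r))"

text \<open>
  The maximal minors of \<open>[v\<^sub>1, \<dots>, v\<^sub>m]\<close>: a strictly increasing \<open>f\<close> selects \<open>e\<close> of the \<open>m\<close> columns,
  keeping their order.
\<close>

definition maximal_minors :: "(nat \<Rightarrow> nat ^ 'e::{finite,linorder}) \<Rightarrow> nat \<Rightarrow> int set" where
  "maximal_minors v m = {det (column_matrix v f) | f. strict_mono f \<and> range f \<subseteq> {1..m}}"

text \<open>
  For \<open>c :: 'e\<close>, \<open>card {..c}\<close> is the position of \<open>c\<close>, counted from 1, so the matrix in the first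
  case is \<open>[v\<^sub>1, \<dots>, v\<^sub>e]\<close>.  The value at \<open>k = 0\<close> is irrelevant.
\<close>

definition D :: "(nat \<Rightarrow> nat ^ 'e::{finite,linorder}) \<Rightarrow> nat \<Rightarrow> int" where
  "D v k = (if k = 1 then \<bar>det (column_matrix v (\<lambda>c. card {..c}))\<bar>
            else Gcd (maximal_minors v (CARD('e) + k - 1)))"

text \<open>
  The quotient is taken in the reals; it is a positive integer as soon as \<open>D v 1 \<noteq> 0\<close> and \<open>k \<ge> 1\<close>.
\<close>

definition D_quot :: "(nat \<Rightarrow> nat ^ 'e::{finite,linorder}) \<Rightarrow> nat \<Rightarrow> real" where
  "D_quot v k = real_of_int (D v k) / real_of_int (D v (k + 1))"

definition frobenius_vec ::
  "(nat \<Rightarrow> nat ^ 'e::{finite,linorder}) \<Rightarrow> nat \<Rightarrow> real ^ 'e::{finite,linorder}" where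
  "frobenius_vec v s =
     (\<Sum>k=1..s. (D_quot v k - 1) *\<^sub>R real_vec (v (CARD('e) + k))) - (\<Sum>i=1..CARD('e). real_vec (v i))"

end

theory Submission
  imports Defs
begin

text \<open>
  Let \<open>G\<^sub>k\<close> be the group generated by the first \<open>e + k - 1\<close> vectors.  Multilinearity of the
  determinant shows that \<open>j v\<^sub>e\<^sub>+\<^sub>k \<in> G\<^sub>k\<close> forces \<open>D\<^sub>k\<close> to divide \<open>j D\<^sub>k\<^sub>+\<^sub>1\<close>, that is, \<open>e\<^sub>k\<close> divides \<open>j\<close>.
  Together with (**) this yields for every element of \<open>G(v)\<close> a unique expression
  \<open>\<Sum> a\<^sub>i v\<^sub>i + \<Sum> b\<^sub>k v\<^sub>e\<^sub>+\<^sub>k\<close> with integers \<open>a\<^sub>i\<close> and \<open>0 \<le> b\<^sub>k < e\<^sub>k\<close>, and the element lies in \<open>\<Gamma>(v)\<close> iff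
  all \<open>a\<^sub>i \<ge> 0\<close>.  The vector \<open>g(v)\<close> has \<open>a\<^sub>i = -1\<close> and \<open>b\<^sub>k = e\<^sub>k - 1\<close>, the extreme values; comparing
  coordinates with respect to \<open>v\<^sub>1, \<dots>, v\<^sub>e\<close> then gives both claims.
\<close>

section \<open>Divisibility of maximal minors\<close>

lemma column_matrix_transpose:
  "transpose (column_matrix v f) = (\<chi> c. \<chi> r. int (v (f c) $ r))"
  by (simp add: column_matrix_def transpose_def vec_eq_iff)

lemma det_column_matrix_noninj:
  assumes "\<not> inj f"
  shows "det (column_matrix v f) = 0"
proof -
  obtain a b where "a \<noteq> b" "f a = f b" using assms by (auto simp: inj_def)
  then have "det (transpose (column_matrix v f)) = 0"
    by (intro det_identical_rows[of a b]) (auto simp: column_matrix_transpose row_def vec_eq_iff)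
  then show ?thesis by simp
qed

text \<open>The matrices differ by the column permutation \<open>inv g \<circ> f\<close>, so their
  determinants agree up to sign; stating divisibility avoids tracking the sign.\<close>

lemma det_column_matrix_dvd_reorder:
  fixes v :: "nat \<Rightarrow> nat ^ 'e::{finite,linorder}"
  assumes "inj f" "inj g" "range f = range g"
  shows "det (column_matrix v g) dvd det (column_matrix v f)"
proof -
  define p where "p = inv g \<circ> f"
  have gp: "g (p c) = f c" for c
    by (metis assms(3) comp_apply f_inv_into_f p_def rangeI)
  have "inj p"
    by (metis assms(1) gp injD injI)
  then have p: "p permutes UNIV"
    by (intro bij_imp_permutes) (auto simp: bij_def finite_UNIV_inj_surj)
  have "column_matrix v f = (\<chi> r c. column_matrix v g $ r $ p c)"
    by (simp add: column_matrix_def gp)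
  then show ?thesis
    by (simp add: det_permute_columns[OF p])
qed

lemma strict_mono_card_atMost: "strict_mono (\<lambda>c::'e::{finite,linorder}. card {..c})"
proof (rule strict_monoI)
  fix x y :: 'e
  assume "x < y"
  then have "{..x} \<subset> {..y}" by force
  then show "card {..x} < card {..y}" by (intro psubset_card_mono) simp
qed

lemma range_card_atMost: "range (\<lambda>c::'e::{finite,linorder}. card {..c}) = {1..CARD('e)}"
proof (rule card_subset_eq)
  show "range (\<lambda>c::'e. card {..c}) \<subseteq> {1..CARD('e)}"
    by (auto simp: card_mono Suc_le_eq card_gt_0_iff)
  show "card (range (\<lambda>c::'e. card {..c})) = card {1..CARD('e)}"
    using strict_mono_card_atMost[where 'e='e] by (simp add: card_image strict_mono_imp_inj_on)
qed simp

text \<open>Sorting an injective choice of columns brings it into the form that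
  \<open>maximal_minors\<close> requires: the increasing enumeration of \<open>range f\<close> is
  composed with the rank function of the index type.\<close>

lemma exists_strict_mono_with_range:
  fixes f :: "'e::{finite,linorder} \<Rightarrow> nat"
  assumes "inj f"
  obtains g :: "'e \<Rightarrow> nat" where "strict_mono g" "range g = range f"
proof -
  obtain h where bij: "bij_betw h {..<card (range f)} (range f)"
    and mono: "strict_mono_on {..<card (range f)} h"
    by (rule ex_bij_betw_strict_mono_card[of "range f"]) auto
  have n: "card (range f) = CARD('e)"
    using assms by (simp add: card_image)
  \<comment> \<open>\<open>card {..c}\<close> counts from 1, while \<open>h\<close> enumerates from
    0.\<close>
  define q where "q = (\<lambda>c::'e. card {..c} - 1)"
  have pos: "card {..c} \<in> {1..CARD('e)}" for c :: 'e
    using range_card_atMost[where 'e='e] by blast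
  have q: "q c \<in> {..<CARD('e)}" for c
    using pos[of c] by (simp add: q_def) linarith
  have qmono: "q c < q d" if "c < d" for c d
    using strict_monoD[OF strict_mono_card_atMost that] pos[of c] by (simp add: q_def diff_less_mono)
  have gmono: "strict_mono (h \<circ> q)"
    using mono q qmono by (auto intro!: strict_monoI simp: strict_mono_on_def n)
  have "range (h \<circ> q) = range f"
  proof (rule card_subset_eq)
    show "range (h \<circ> q) \<subseteq> range f"
      using bij q by (auto simp: bij_betw_def n)
    show "card (range (h \<circ> q)) = card (range f)"
      using gmono n by (simp only: card_image strict_mono_imp_inj_on)
  qed simp
  with gmono show thesis using that by blast
qed

text \<open>Selections out of order or with repetition are allowed, since exchanging a single column
  below can produce them. A repetition gives determinant 0; otherwise sorting costs at most a
  sign.\<close>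

lemma D_dvd_det:
  fixes v :: "nat \<Rightarrow> nat ^ 'e::{finite,linorder}"
  assumes "k \<ge> 1" "range f \<subseteq> {1..CARD('e) + k - 1}"
  shows "D v k dvd det (column_matrix v f)"
proof (cases "inj f")
  case False
  then show ?thesis by (simp add: det_column_matrix_noninj)
next
  case inj: True
  show ?thesis
  proof (cases "k = 1")
    case True
    \<comment> \<open>Only \<open>CARD('e)\<close> columns are available, so an injective selection
      uses all of them.\<close>
    have "range f = {1..CARD('e)}"
      using assms inj True by (intro card_subset_eq) (auto simp: card_image)
    then have "det (column_matrix v (\<lambda>c. card {..c})) dvd det (column_matrix v f)"
      using inj by (intro det_column_matrix_dvd_reorder)
        (simp_all add: range_card_atMost strict_mono_imp_inj_on strict_mono_card_atMost)
    then show ?thesis by (simp add: D_def True)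
  next
    case False
    obtain g :: "'e \<Rightarrow> nat" where g: "strict_mono g" "range g = range f"
      using exists_strict_mono_with_range[OF inj] by blast
    then have "D v k dvd det (column_matrix v g)"
      using assms False by (auto simp: D_def maximal_minors_def intro!: Gcd_dvd)
    also have "\<dots> dvd det (column_matrix v f)"
      using g inj by (intro det_column_matrix_dvd_reorder) (simp_all add: strict_mono_imp_inj_on)
    finally show ?thesis .
  qed
qed

text \<open>The universal property of the gcd, with a multiplier \<open>a\<close> that passes
  through the gcd up to a unit.\<close>

lemma dvd_D:
  fixes v :: "nat \<Rightarrow> nat ^ 'e::{finite,linorder}"
  assumes "k \<ge> 1"
    and "\<And>f :: 'e \<Rightarrow> nat. range f \<subseteq> {1..CARD('e) + k - 1} \<Longrightarrow> d dvd a * det (column_matrix v f)"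
  shows "d dvd a * D v k"
proof (cases "k = 1")
  case True
  then show ?thesis
    using assms(2)[of "\<lambda>c. card {..c}"] by (simp add: D_def range_card_atMost abs_if)
next
  case False
  have "d dvd (GCD m\<in>maximal_minors v (CARD('e) + k - 1). a * m)"
    using assms(2) by (intro Gcd_greatest) (auto simp: maximal_minors_def)
  also have "\<dots> = normalize (a * Gcd (maximal_minors v (CARD('e) + k - 1)))"
    by (rule Gcd_mult)
  finally show ?thesis
    using False by (simp add: D_def)
qed

text \<open>Every minor of the smaller matrix is also a minor of the larger one.\<close>

lemma D_Suc_dvd_D:
  fixes v :: "nat \<Rightarrow> nat ^ 'e::{finite,linorder}"
  assumes "k \<ge> 1"
  shows "D v (k + 1) dvd D v k"
proof -
  have "D v (k + 1) dvd 1 * D v k"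
    using assms by (intro dvd_D) (fastforce intro: D_dvd_det)+
  then show ?thesis by simp
qed

text \<open>In a minor containing the new column, scale that column by \<open>j\<close> and expand
  it along the given relation: only minors in earlier columns remain, and \<open>D v k\<close>
  divides each of them. Minors without the new column are divisible by \<open>D v k\<close>
  anyway.\<close>

lemma D_dvd_mult_D_Suc:
  fixes v :: "nat \<Rightarrow> nat ^ 'e::{finite,linorder}"
  assumes k: "k \<ge> 1"
    and mem: "real_of_int j *\<^sub>R real_vec (v (CARD('e) + k)) \<in> gen_group v (CARD('e) + k - 1)"
  shows "D v k dvd j * D v (k + 1)"
proof (rule dvd_D)
  fix f :: "'e \<Rightarrow> nat"
  assume f: "range f \<subseteq> {1..CARD('e) + (k + 1) - 1}"
  define m where "m = CARD('e) + k - 1"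
  define u where "u i = (\<chi> r. int (v i $ r))" for i
  have m: "CARD('e) + k = Suc m" using k by (simp add: m_def)
  obtain a :: "nat \<Rightarrow> int" where
    "real_of_int j *\<^sub>R real_vec (v (Suc m)) = (\<Sum>i=1..m. real_of_int (a i) *\<^sub>R real_vec (v i))"
    using mem by (auto simp: gen_group_def m_def[symmetric] m)
  \<comment> \<open>The real relation is pulled back to integer vectors coordinatewise, so that
    integer determinants apply to it.\<close>
  then have "real_of_int (j * u (Suc m) $ r) = real_of_int (\<Sum>i=1..m. a i * u i $ r)" for r
    by (simp add: vec_eq_iff real_vec_def u_def)
  then have ju: "j *s u (Suc m) = (\<Sum>i=1..m. a i *s u i)"
    unfolding of_int_eq_iff by (simp add: vec_eq_iff)
  have range: "f c \<in> {1..Suc m}" for c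
    using f m rangeI[of f c] by fastforce
  show "D v k dvd j * det (column_matrix v f)"
  proof (cases "inj f \<and> Suc m \<in> range f")
    case False
    then show ?thesis
    proof (cases "inj f")
      case True
      then have "f c \<noteq> Suc m" for c
        using False by (metis rangeI)
      then have "range f \<subseteq> {1..m}"
        using range by (force simp: le_Suc_eq)
      then show ?thesis
        using k by (intro dvd_mult D_dvd_det) (auto simp: m_def)
    qed (simp add: det_column_matrix_noninj)
  next
    case True
    then obtain c0 where c0: "f c0 = Suc m" by auto
    \<comment> \<open>Transposition turns the selected columns into rows, to which the row-linearity
      rules for \<open>det\<close> apply.\<close>
    have upd: "det (\<chi> c. if c = c0 then u i else u (f c)) = det (column_matrix v (f(c0 := i)))" for i
    proof -
      have "(\<chi> c. if c = c0 then u i else u (f c)) = transpose (column_matrix v (f(c0 := i)))"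
        by (simp add: column_matrix_transpose u_def vec_eq_iff)
      then show ?thesis by simp
    qed
    have "j * det (column_matrix v f) = j * det (column_matrix v (f(c0 := Suc m)))"
      by (simp flip: c0)
    also have "\<dots> = det (\<chi> c. if c = c0 then (\<Sum>i=1..m. a i *s u i) else u (f c))"
      unfolding upd[symmetric] det_row_mul[symmetric] ju by (rule refl)
    also have "\<dots> = (\<Sum>i=1..m. a i * det (column_matrix v (f(c0 := i))))"
      by (simp add: det_linear_row_sum det_row_mul upd)
    finally have "j * det (column_matrix v f) = (\<Sum>i=1..m. a i * det (column_matrix v (f(c0 := i))))" .
    moreover have "D v k dvd det (column_matrix v (f(c0 := i)))" if "i \<in> {1..m}" for i
    proof (rule D_dvd_det[OF k])
      \<comment> \<open>By injectivity \<open>c0\<close> is the only position that selects column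
        \<open>Suc m\<close>.\<close>
      have "f c \<in> {1..m}" if "c \<noteq> c0" for c
        using range[of c] injD[of f c c0] True c0 that by (auto simp: le_Suc_eq)
      then show "range (f(c0 := i)) \<subseteq> {1..CARD('e) + k - 1}"
        using that by (auto simp: m_def)
    qed
    ultimately show ?thesis
      by (auto intro!: dvd_sum dvd_mult)
  qed
qed simp

section \<open>Standard representations\<close>

text \<open>A common frame for the group (\<open>A = UNIV\<close>) and the semigroup
  (\<open>A = {0..}\<close>), so that coefficient reduction is proved once for both.\<close>

definition int_combinations :: "int set \<Rightarrow> (nat \<Rightarrow> nat ^ 'e) \<Rightarrow> nat \<Rightarrow> (real ^ 'e) set" where
  "int_combinations A v m = {\<Sum>i=1..m. real_of_int (a i) *\<^sub>R real_vec (v i) | a. range a \<subseteq> A}"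

lemma gen_group_eq: "gen_group v m = int_combinations UNIV v m"
  by (simp add: gen_group_def int_combinations_def)

lemma gen_semigroup_eq: "gen_semigroup v m = int_combinations {0..} v m"
proof -
  have "\<exists>b. (\<Sum>i=1..m. real (a i) *\<^sub>R real_vec (v i)) = (\<Sum>i=1..m. real_of_int (b i) *\<^sub>R real_vec (v i))
          \<and> range b \<subseteq> {0..}" for a
    by (intro exI[of _ "\<lambda>i. int (a i)"]) auto
  moreover have "\<exists>a. (\<Sum>i=1..m. real_of_int (b i) *\<^sub>R real_vec (v i)) = (\<Sum>i=1..m. real (a i) *\<^sub>R real_vec (v i))"
    if "range b \<subseteq> {0..}" for b
    using that by (intro exI[of _ "\<lambda>i. nat (b i)"]) (auto simp: image_subset_iff)
  ultimately show ?thesis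
    unfolding gen_semigroup_def int_combinations_def by blast
qed

lemma int_combinations_mono: "A \<subseteq> B \<Longrightarrow> int_combinations A v m \<subseteq> int_combinations B v m"
  unfolding int_combinations_def by blast

lemma int_combinations_add_mult:
  assumes A: "A = UNIV \<or> A = {0..}"
    and "x \<in> int_combinations A v m" "y \<in> int_combinations A v m" "q \<in> A"
  shows "x + real_of_int q *\<^sub>R y \<in> int_combinations A v m"
proof -
  obtain a b where "x = (\<Sum>i=1..m. real_of_int (a i) *\<^sub>R real_vec (v i))" "range a \<subseteq> A"
    "y = (\<Sum>i=1..m. real_of_int (b i) *\<^sub>R real_vec (v i))" "range b \<subseteq> A"
    using assms by (auto simp: int_combinations_def)
  then show ?thesis
    using A \<open>q \<in> A\<close> unfolding int_combinations_def
    by (intro CollectI exI[of _ "\<lambda>i. a i + q * b i"])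
      (auto simp: sum.distrib scaleR_sum_right scaleR_add_left image_subset_iff)
qed

text \<open>Division with remainder, from the last vector downwards: by \<open>free\<close>, the
  quotient times \<open>E k\<close> copies of the vector is absorbed into the earlier vectors, and
  the remainder becomes its coefficient. For \<open>A = {0..}\<close> no step introduces a negative
  coefficient.\<close>

lemma standard_representation_exists:
  fixes v :: "nat \<Rightarrow> nat ^ 'e"
  assumes A: "A = UNIV \<or> A = {0..}"
    and pos: "\<And>k. k \<in> {1..s} \<Longrightarrow> E k > 0"
    and free: "\<And>k. k \<in> {1..s} \<Longrightarrow>
      real_of_int (E k) *\<^sub>R real_vec (v (n + k)) \<in> int_combinations A v (n + k - 1)"
    and x: "x \<in> int_combinations A v (n + s)"
  shows "\<exists>c. x = (\<Sum>i=1..n+s. real_of_int (c i) *\<^sub>R real_vec (v i)) \<and> range c \<subseteq> A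
    \<and> (\<forall>k\<in>{1..s}. 0 \<le> c (n + k) \<and> c (n + k) < E k)"
  using pos free x
proof (induction s arbitrary: x)
  case 0
  then show ?case by (auto simp: int_combinations_def)
next
  case (Suc s)
  define q where "q a = a div E (Suc s)" for a
  let ?w = "\<lambda>i. real_vec (v i)"
  have E: "E (Suc s) > 0" using Suc.prems(1) by simp
  obtain a where x: "x = (\<Sum>i=1..n + Suc s. real_of_int (a i) *\<^sub>R ?w i)" and a: "range a \<subseteq> A"
    using Suc.prems(3) by (auto simp: int_combinations_def)
  define b where "b = a (n + Suc s)"
  have "q b \<in> A"
    using A a E by (auto simp: q_def b_def image_subset_iff pos_imp_zdiv_nonneg_iff)
  moreover have "(\<Sum>i=1..n + s. real_of_int (a i) *\<^sub>R ?w i) \<in> int_combinations A v (n + s)"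
    using a by (auto simp: int_combinations_def)
  moreover have "real_of_int (E (Suc s)) *\<^sub>R ?w (n + Suc s) \<in> int_combinations A v (n + s)"
    using Suc.prems(2)[of "Suc s"] by simp
  ultimately have "(\<Sum>i=1..n + s. real_of_int (a i) *\<^sub>R ?w i)
      + real_of_int (q b) *\<^sub>R (real_of_int (E (Suc s)) *\<^sub>R ?w (n + Suc s)) \<in> int_combinations A v (n + s)"
    using A by (intro int_combinations_add_mult) auto
  from Suc.IH[OF _ _ this] Suc.prems(1,2) obtain c where
    c: "(\<Sum>i=1..n + s. real_of_int (a i) *\<^sub>R ?w i)
      + real_of_int (q b) *\<^sub>R (real_of_int (E (Suc s)) *\<^sub>R ?w (n + Suc s))
      = (\<Sum>i=1..n+s. real_of_int (c i) *\<^sub>R ?w i)" "range c \<subseteq> A"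
      "\<forall>k\<in>{1..s}. 0 \<le> c (n + k) \<and> c (n + k) < E k"
    by auto
  define d where "d = c(n + Suc s := b mod E (Suc s))"
  have "real_of_int b = real_of_int (q b * E (Suc s) + b mod E (Suc s))"
    by (simp add: q_def)
  then have b: "real_of_int b = real_of_int (q b) * real_of_int (E (Suc s)) + real_of_int (b mod E (Suc s))"
    by simp
  have "x = (\<Sum>i=1..n + s. real_of_int (a i) *\<^sub>R ?w i) + real_of_int b *\<^sub>R ?w (n + Suc s)"
    by (simp add: x b_def)
  also have "\<dots> = (\<Sum>i=1..n+s. real_of_int (c i) *\<^sub>R ?w i) + real_of_int (b mod E (Suc s)) *\<^sub>R ?w (n + Suc s)"
    using c(1) unfolding b by (simp add: scaleR_add_left add.assoc[symmetric])
  also have "\<dots> = (\<Sum>i=1..n + Suc s. real_of_int (d i) *\<^sub>R ?w i)"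
    by (simp add: d_def)
  finally have "x = (\<Sum>i=1..n + Suc s. real_of_int (d i) *\<^sub>R ?w i)" .
  moreover have "range d \<subseteq> A"
    using A c(2) E by (auto simp: d_def image_subset_iff)
  moreover have "\<forall>k\<in>{1..Suc s}. 0 \<le> d (n + k) \<and> d (n + k) < E k"
    using c(3) E by (auto simp: d_def le_Suc_eq)
  ultimately show ?case by blast
qed

text \<open>Meant for the difference of two standard representations. The last term lies in the
  group of the earlier vectors, so \<open>E k\<close> divides its coefficient, which is smaller in
  absolute value and hence 0; induction removes the remaining ones.\<close>

lemma standard_representation_unique:
  fixes v :: "nat \<Rightarrow> nat ^ 'e::{finite,linorder}"
  assumes "\<And>k. k \<in> {1..s} \<Longrightarrow> D v k = E k * D v (k + 1) \<and> D v (k + 1) > 0"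
    and "\<And>k. k \<in> {1..s} \<Longrightarrow> \<bar>c (CARD('e) + k)\<bar> < E k"
    and "(\<Sum>i=1..CARD('e)+s. real_of_int (c i) *\<^sub>R real_vec (v i)) = 0"
  shows "(\<Sum>i=1..CARD('e). real_of_int (c i) *\<^sub>R real_vec (v i)) = 0"
  using assms
proof (induction s)
  case (Suc s)
  let ?w = "\<lambda>i. real_vec (v i)"
  let ?j = "c (CARD('e) + Suc s)"
  have "(\<Sum>i=1..CARD('e)+s. real_of_int (c i) *\<^sub>R ?w i) + real_of_int ?j *\<^sub>R ?w (CARD('e) + Suc s) = 0"
    using Suc.prems(3) by simp
  then have eq: "real_of_int ?j *\<^sub>R ?w (CARD('e) + Suc s) = (\<Sum>i=1..CARD('e)+s. real_of_int (- c i) *\<^sub>R ?w i)"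
    by (simp add: sum_negf eq_neg_iff_add_eq_0 add.commute)
  then have "real_of_int ?j *\<^sub>R ?w (CARD('e) + Suc s) \<in> gen_group v (CARD('e) + Suc s - 1)"
    unfolding gen_group_def by (intro CollectI exI[of _ "\<lambda>i. - c i"]) simp
  then have "D v (Suc s) dvd ?j * D v (Suc s + 1)"
    by (intro D_dvd_mult_D_Suc) auto
  moreover have "D v (Suc s) = E (Suc s) * D v (Suc s + 1)" "D v (Suc s + 1) > 0"
    using Suc.prems(1)[of "Suc s"] by auto
  ultimately have "E (Suc s) dvd ?j" by simp
  then have "?j = 0"
    using Suc.prems(2)[of "Suc s"] dvd_imp_le_int[of ?j "E (Suc s)"] by fastforce
  then have "(\<Sum>i=1..CARD('e)+s. real_of_int (c i) *\<^sub>R ?w i) = 0"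
    using Suc.prems(3) by simp
  with Suc.prems(1,2) show ?case by (intro Suc.IH) (meson atLeastAtMost_iff le_SucI)+
qed simp

section \<open>Coordinates with respect to the first vectors\<close>

text \<open>A spanning family with as many members as the dimension is a basis. Counting also gives
  injectivity of \<open>w\<close>, which transfers independence from the image to the
  family.\<close>

lemma spanning_family_coeffs_eq_0:
  fixes w :: "nat \<Rightarrow> 'a::euclidean_space"
  assumes span: "span (w ` {1..DIM('a)}) = UNIV"
    and zero: "(\<Sum>i=1..DIM('a). c i *\<^sub>R w i) = 0" and i: "i \<in> {1..DIM('a)}"
  shows "c i = 0"
proof -
  let ?I = "{1..DIM('a)}"
  have dim: "DIM('a) = dim (w ` ?I)"
    using span by (metis dim_UNIV dim_span)
  also have "\<dots> \<le> card (w ` ?I)"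
    by (intro dim_le_card') simp
  finally have card: "card (w ` ?I) = card ?I"
    using card_image_le[of ?I w] by simp
  then have inj: "inj_on w ?I"
    by (intro eq_card_imp_inj_on) auto
  have ind: "independent (w ` ?I)"
    using card_le_dim_spanning[of "w ` ?I" UNIV] span card by simp
  have "(\<Sum>x\<in>w ` ?I. c (inv_into ?I w x) *\<^sub>R x) = 0"
    using zero inj by (simp add: sum.reindex)
  with ind have "c (inv_into ?I w (w i)) = 0"
    using i by (intro independentD[of "w ` ?I" "w ` ?I"]) auto
  then show ?thesis using inj i by simp
qed

text \<open>Moving from \<open>x\<close> slightly against the sum \<open>z\<close> of the generators
  stays in the cone; adding \<open>t *\<^sub>R z\<close> back raises all the nonnegative
  coefficients by \<open>t\<close>.\<close>

lemma interior_gen_cone_pos: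
  assumes "x \<in> interior (gen_cone v n)"
  obtains y where "x = (\<Sum>i=1..n. y i *\<^sub>R real_vec (v i))" "\<And>i. y i > 0"
proof -
  define z where "z = (\<Sum>i=1..n. real_vec (v i))"
  obtain d where d: "d > 0" "ball x d \<subseteq> gen_cone v n"
    using assms by (meson mem_interior)
  \<comment> \<open>The summand 1 covers \<open>z = 0\<close> and makes
    \<open>norm (t *\<^sub>R z)\<close> strictly less than \<open>d\<close>.\<close>
  define t where "t = d / (norm z + 1)"
  have nz: "norm z + 1 > 0" by (simp add: add_nonneg_pos)
  have t: "t > 0" using d nz by (simp add: t_def)
  have "norm (t *\<^sub>R z) = d * (norm z / (norm z + 1))" using d nz by (simp add: t_def)
  also have "\<dots> < d * 1" using d nz by (intro mult_strict_left_mono) simp_all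
  finally have "x - t *\<^sub>R z \<in> gen_cone v n"
    using d by (auto simp: dist_norm)
  then obtain a where a: "x - t *\<^sub>R z = (\<Sum>i=1..n. a i *\<^sub>R real_vec (v i))" "\<forall>i. a i \<ge> 0"
    by (auto simp: gen_cone_def)
  then have "x = (\<Sum>i=1..n. (a i + t) *\<^sub>R real_vec (v i))"
    by (simp add: z_def scaleR_add_left sum.distrib scaleR_sum_right algebra_simps)
  then show thesis
    using that[of "\<lambda>i. a i + t"] a t by (simp add: add_nonneg_pos)
qed

lemma sum_atLeastAtMost_split:
  fixes f :: "nat \<Rightarrow> 'a::comm_monoid_add"
  shows "(\<Sum>i=1..n+s. f i) = (\<Sum>i=1..n. f i) + (\<Sum>k=1..s. f (n + k))"
  by (induction s) (simp_all add: add.assoc)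

section \<open>Comparison of g(v) with standard representations\<close>

theorem theorem1:
  fixes v :: "nat \<Rightarrow> nat ^ 'e::{finite,linorder}" and s :: nat
  assumes "s \<ge> 1"
    and nonzero: "\<forall>i\<in>{1..CARD('e) + s}. v i \<noteq> 0"
    and spanning: "span ((\<lambda>i. real_vec (v i)) ` {1..CARD('e)}) = (UNIV :: (real ^ 'e::{finite,linorder}) set)"
    and in_cone: "\<forall>k\<in>{1..s}. real_vec (v (CARD('e) + k)) \<in> gen_cone v (CARD('e))"
    and D_decreasing: "\<forall>k\<in>{1..s}. D v k > D v (k + 1)"
    and free: "\<forall>k\<in>{1..s}. D_quot v k *\<^sub>R real_vec (v (CARD('e) + k))
                 \<in> gen_semigroup v (CARD('e) + k - 1)"
  shows "frobenius_vec v s \<notin> gen_semigroup v (CARD('e) + s) \<and>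
    (\<forall>x \<in> (\<lambda>y. frobenius_vec v s + y) ` (interior (gen_cone v (CARD('e))) - {0}).
        x \<in> gen_group v (CARD('e) + s) \<longrightarrow> x \<in> gen_semigroup v (CARD('e) + s))"
proof -
  let ?n = "CARD('e)"
  let ?w = "\<lambda>i. real_vec (v i)"
  define E where "E k = D v k div D v (k + 1)" for k
  have pos: "D v k > 0" and pos': "D v (k + 1) > 0" and DE: "D v k = E k * D v (k + 1)"
    if k: "k \<in> {1..s}" for k
  proof -
    \<comment> \<open>As \<open>k + 1\<close> is at least 2, this is a \<open>Gcd\<close> and hence
      nonnegative; strict decrease then makes \<open>D v k\<close> positive.\<close>
    have "D v (k + 1) \<ge> 0" using k by (simp add: D_def)
    then show 1: "D v k > 0" using D_decreasing k by force
    have dvd: "D v (k + 1) dvd D v k" using k by (intro D_Suc_dvd_D) simp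
    with 1 have "D v (k + 1) \<noteq> 0" by auto
    with \<open>D v (k + 1) \<ge> 0\<close> show "D v (k + 1) > 0" by simp
    show "D v k = E k * D v (k + 1)" using dvd by (simp add: E_def)
  qed
  have Epos: "E k > 0" if "k \<in> {1..s}" for k
    using DE[OF that] pos[OF that] pos'[OF that] by (simp add: zero_less_mult_iff)
  have quot: "D_quot v k = real_of_int (E k)" if "k \<in> {1..s}" for k
    using DE[OF that] pos'[OF that] by (simp add: D_quot_def)
  have free': "real_of_int (E k) *\<^sub>R ?w (?n + k) \<in> int_combinations A v (?n + k - 1)"
    if "k \<in> {1..s}" "A = UNIV \<or> A = {0..}" for k A
    using bspec[OF free that(1)] that int_combinations_mono[of "{0..}" A v "?n + k - 1"]
    by (auto simp: quot gen_semigroup_eq)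
  have frob: "frobenius_vec v s = (\<Sum>k=1..s. real_of_int (E k - 1) *\<^sub>R ?w (?n + k)) - (\<Sum>i=1..?n. ?w i)"
    unfolding frobenius_vec_def by (simp add: quot)
  have indep: "c i = 0" if "(\<Sum>i=1..?n. c i *\<^sub>R ?w i) = 0" "i \<in> {1..?n}" for c i
    using spanning_family_coeffs_eq_0[of ?w c i] spanning that by simp
  have "frobenius_vec v s \<notin> gen_semigroup v (?n + s)"
  proof
    assume "frobenius_vec v s \<in> gen_semigroup v (?n + s)"
    then obtain c where c: "frobenius_vec v s = (\<Sum>i=1..?n+s. real_of_int (c i) *\<^sub>R ?w i)"
        "range c \<subseteq> {0..}" "\<forall>k\<in>{1..s}. 0 \<le> c (?n + k) \<and> c (?n + k) < E k"
      using standard_representation_exists[of "{0..}" s E v ?n] Epos free'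
      unfolding gen_semigroup_eq by blast
    \<comment> \<open>Subtract from \<open>c\<close> the coefficients of g(v): -1 on the first
      \<open>?n\<close> vectors and \<open>E k - 1\<close> on the others. The latter and
      \<open>c (?n + k)\<close> both lie between 0 and \<open>E k - 1\<close>, so uniqueness applies
      to \<open>d\<close>.\<close>
    define d where "d i = (if i \<le> ?n then c i + 1 else c i - (E (i - ?n) - 1))" for i
    have "(\<Sum>i=1..?n+s. real_of_int (d i) *\<^sub>R ?w i)
        = (\<Sum>i=1..?n. real_of_int (c i + 1) *\<^sub>R ?w i)
          + (\<Sum>k=1..s. real_of_int (c (?n + k) - (E k - 1)) *\<^sub>R ?w (?n + k))"
      unfolding sum_atLeastAtMost_split by (intro arg_cong2[of _ _ _ _ "(+)"] sum.cong) (auto simp: d_def)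
    also have "\<dots> = (\<Sum>i=1..?n+s. real_of_int (c i) *\<^sub>R ?w i) - frobenius_vec v s"
      unfolding sum_atLeastAtMost_split frob of_int_add of_int_diff scaleR_add_left scaleR_diff_left
        sum.distrib sum_subtractf by simp
    finally have zero: "(\<Sum>i=1..?n+s. real_of_int (d i) *\<^sub>R ?w i) = 0"
      using c(1) by simp
    have "\<bar>d (?n + k)\<bar> < E k" if "k \<in> {1..s}" for k
      using bspec[OF c(3) that] that by (simp add: d_def abs_less_iff)
    then have "(\<Sum>i=1..?n. real_of_int (d i) *\<^sub>R ?w i) = 0"
      using DE pos' zero by (intro standard_representation_unique[of s v E]) auto
    \<comment> \<open>Position 1 exists because the index type is nonempty; there
      \<open>d 1 = c 1 + 1\<close>, which cannot vanish.\<close>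
    then have "real_of_int (d 1) = 0"
      by (rule indep) (simp add: Suc_le_eq)
    moreover have "c 1 \<ge> 0" using c(2) by auto
    ultimately show False by (auto simp: d_def Suc_le_eq)
  qed
  \<comment> \<open>Claim ii: in a standard representation over the integers the last
    \<open>s\<close> coefficients are nonnegative by construction, so only the first
    \<open>?n\<close> need an argument.\<close>
  moreover have "frobenius_vec v s + x \<in> gen_semigroup v (?n + s)"
    if x: "x \<in> interior (gen_cone v ?n)" and grp: "frobenius_vec v s + x \<in> gen_group v (?n + s)" for x
  proof -
    obtain y where y: "x = (\<Sum>i=1..?n. y i *\<^sub>R ?w i)" and ypos: "\<And>i. y i > 0"
      using interior_gen_cone_pos[OF x] by blast
    obtain c where c: "frobenius_vec v s + x = (\<Sum>i=1..?n+s. real_of_int (c i) *\<^sub>R ?w i)"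
        "\<forall>k\<in>{1..s}. 0 \<le> c (?n + k) \<and> c (?n + k) < E k"
      using standard_representation_exists[of UNIV s E v ?n] Epos free' grp
      unfolding gen_group_eq by blast
    have "\<forall>k\<in>{1..s}. \<exists>p. ?w (?n + k) = (\<Sum>i=1..?n. p i *\<^sub>R ?w i) \<and> (\<forall>i. p i \<ge> 0)"
      using in_cone by (auto simp: gen_cone_def)
    then obtain p where p: "\<And>k. k \<in> {1..s} \<Longrightarrow> ?w (?n + k) = (\<Sum>i=1..?n. p k i *\<^sub>R ?w i)"
        "\<And>k i. k \<in> {1..s} \<Longrightarrow> p k i \<ge> 0"
      by metis
    \<comment> \<open>The slack of \<open>c (?n + k)\<close> below its extreme value
      \<open>E k - 1\<close>.\<close>
    define r where "r k = real_of_int (E k - 1 - c (?n + k))" for k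
    have rnonneg: "r k \<ge> 0" if "k \<in> {1..s}" for k
      unfolding r_def of_int_0_le_iff using bspec[OF c(2) that] by simp
    have "(\<Sum>k=1..s. r k *\<^sub>R ?w (?n + k)) = (\<Sum>k=1..s. \<Sum>i=1..?n. (r k * p k i) *\<^sub>R ?w i)"
      by (intro sum.cong) (simp_all add: p(1) scaleR_sum_right)
    also have "\<dots> = (\<Sum>i=1..?n. (\<Sum>k=1..s. r k * p k i) *\<^sub>R ?w i)"
      by (subst sum.swap) (simp add: scaleR_sum_left)
    finally have r: "(\<Sum>k=1..s. r k *\<^sub>R ?w (?n + k)) = (\<Sum>i=1..?n. (\<Sum>k=1..s. r k * p k i) *\<^sub>R ?w i)" .
    \<comment> \<open>Comparing coordinates in the basis of the first \<open>?n\<close> vectors will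
      give \<open>c i = y i - 1 + (\<Sum>k=1..s. r k * p k i)\<close>. With \<open>y i > 0\<close>
      and a nonnegative sum, the integer \<open>c i\<close> exceeds -1.\<close>
    have "(\<Sum>i=1..?n. (y i - 1 + (\<Sum>k=1..s. r k * p k i) - real_of_int (c i)) *\<^sub>R ?w i)
        = x - (\<Sum>i=1..?n. ?w i) + (\<Sum>k=1..s. r k *\<^sub>R ?w (?n + k))
          - (\<Sum>i=1..?n. real_of_int (c i) *\<^sub>R ?w i)"
      unfolding r y by (simp add: scaleR_add_left scaleR_diff_left sum.distrib sum_subtractf)
    also have "(\<Sum>k=1..s. r k *\<^sub>R ?w (?n + k)) = (\<Sum>k=1..s. real_of_int (E k - 1) *\<^sub>R ?w (?n + k))
        - (\<Sum>k=1..s. real_of_int (c (?n + k)) *\<^sub>R ?w (?n + k))"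
      unfolding r_def of_int_diff[of "_ - 1"] by (simp only: scaleR_diff_left sum_subtractf)
    also have "x - (\<Sum>i=1..?n. ?w i) + ((\<Sum>k=1..s. real_of_int (E k - 1) *\<^sub>R ?w (?n + k))
        - (\<Sum>k=1..s. real_of_int (c (?n + k)) *\<^sub>R ?w (?n + k))) - (\<Sum>i=1..?n. real_of_int (c i) *\<^sub>R ?w i) = 0"
      using c(1) unfolding frob sum_atLeastAtMost_split by (simp add: algebra_simps)
    finally have zero: "(\<Sum>i=1..?n. (y i - 1 + (\<Sum>k=1..s. r k * p k i) - real_of_int (c i)) *\<^sub>R ?w i) = 0" .
    have cpos: "c i \<ge> 0" if i: "i \<in> {1..?n}" for i
    proof -
      have "(\<Sum>k=1..s. r k * p k i) \<ge> 0"
        using p(2) rnonneg by (intro sum_nonneg mult_nonneg_nonneg) auto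
      then have "real_of_int (c i) > - 1"
        using indep[OF zero i] ypos[of i] by simp
      then show ?thesis by linarith
    qed
    have nonneg: "c i \<ge> 0" if "i \<in> {1..?n+s}" for i
    proof (cases "i \<le> ?n")
      case False
      then show ?thesis using bspec[OF c(2), of "i - ?n"] that by (simp add: Suc_le_eq le_diff_conv)
    qed (use cpos that in simp)
    have "frobenius_vec v s + x = (\<Sum>i=1..?n+s. real (nat (c i)) *\<^sub>R ?w i)"
      unfolding c(1) using nonneg by (intro sum.cong) auto
    then show ?thesis unfolding gen_semigroup_def by (intro CollectI exI[of _ "\<lambda>i. nat (c i)"]) simp
  qed
  ultimately show ?thesis by auto
qed

end
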